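(* Let $G$ be the graph with the 23 vertices $w_1,a_1,a_2,a_3,b_1,b_2,b_3,b_4,c_1,c_2,c_3,c_4,c_5,d_1,d_2,d_3,e_1,e_2,e_3,f_1,f_2,f_3,w_2$ and the following 60 edges: $w_1a_1, w_1a_2, w_1a_3$; $a_1a_2, a_2a_3, a_1b_1, a_1b_2, a_1b_3, a_2b_2, a_2b_3, a_2b_4, a_3b_3, a_3b_4$; $b_1b_2, b_2b_3, b_3b_4, b_1c_1, b_1c_2, b_1c_3, b_2c_2, b_2c_3, b_2c_4, b_3c_3, b_3c_4, b_3c_5, b_4c_4, b_4c_5$; $c_1c_2, c_2c_3, c_3c_4, c_4c_5, c_1d_1, c_1d_2, c_1d_3, c_2d_2, c_2d_3, c_3d_3$; $d_1d_2, d_2d_3, d_1e_1, d_1e_2, d_2e_1, d_2e_2, d_2e_3, d_3e_2, d_3e_3, d_1w_2$; $e_1e_2, e_2e_3, e_1f_1, e_1f_2, e_2f_1, e_2f_2, e_2f_3, e_3f_2, e_3f_3, e_1w_2$; $f_1f_2, f_2f_3, f_1w_2$. Then $\tau_s(G)>2$, i.e., there is no graph $H$ having $G$ as a spanning subgraph with $\beta_s(H)=2$.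
   Context: For vertices $u,v,w$ of a connected graph, $w$ strongly resolves $u,v$ if there is a shortest $u$-$w$ path containing $v$ or a shortest $v$-$w$ path containing $u$. A strong resolving set is a set $W$ such that every pair of vertices is strongly resolved by some vertex of $W$; the strong dimension $\beta_s(H)$ is the minimum size of a strong resolving set of $H$. The threshold strong dimension $\tau_s(G)$ is the minimum of $\beta_s(H)$ over all graphs $H$ having $G$ as a spanning subgraph. *)

theory Defs
  imports "Graph_Theory.Graph_Theory"
begin

text \<open>
  Finite simple graphs are \<^locale>\<open>pair_graph\<close>s: loop-free, with a symmetric arc relation, so that
  an edge is represented by its two orientations.
\<close>

definition shortest_path :: "'a pair_pre_digraph \<Rightarrow> 'a \<Rightarrow> 'a list \<Rightarrow> 'a \<Rightarrow> bool" where
  "shortest_path G u p v \<longleftrightarrow>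
     vpath p (with_proj G) \<and> hd p = u \<and> last p = v \<and>
     (\<forall>q. vpath q (with_proj G) \<and> hd q = u \<and> last q = v \<longrightarrow> vwalk_length p \<le> vwalk_length q)"

definition strongly_resolves :: "'a pair_pre_digraph \<Rightarrow> 'a \<Rightarrow> 'a \<Rightarrow> 'a \<Rightarrow> bool" where
  "strongly_resolves G w u v \<longleftrightarrow>
     (\<exists>p. shortest_path G u p w \<and> v \<in> set p) \<or> (\<exists>p. shortest_path G v p w \<and> u \<in> set p)"

text \<open>A pair of vertices means a pair of distinct vertices.\<close>

definition strong_resolving_set :: "'a pair_pre_digraph \<Rightarrow> 'a set \<Rightarrow> bool" where
  "strong_resolving_set G W \<longleftrightarrow>
     W \<subseteq> pverts G \<and>
     (\<forall>u \<in> pverts G. \<forall>v \<in> pverts G. u \<noteq> v \<longrightarrow> (\<exists>w \<in> W. strongly_resolves G w u v))"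

text \<open>
  Both minima below are attained when \<open>G\<close> is finite and connected: the set of all vertices of a
  connected graph is strongly resolving, and \<open>G\<close> is a spanning subgraph of itself.
  Every graph that has \<open>G\<close> as a spanning subgraph is then connected as well.
  For other arguments the values are meaningless.
\<close>

definition strong_dim :: "'a pair_pre_digraph \<Rightarrow> nat" where
  "strong_dim G = (LEAST k. \<exists>W. strong_resolving_set G W \<and> card W = k)"

text \<open>\<^term>\<open>spanning G H\<close> says that \<open>G\<close> is the subgraph and \<open>H\<close> the supergraph.\<close>

definition threshold_strong_dim :: "'a pair_pre_digraph \<Rightarrow> nat" where
  "threshold_strong_dim G =
     (LEAST k. \<exists>H. pair_graph H \<and> spanning (with_proj G) (with_proj H) \<and> strong_dim H = k)"

datatype vertex =
    W1 | A1 | A2 | A3 | B1 | B2 | B3 | B4 | C1 | C2 | C3 | C4 | C5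
  | D1 | D2 | D3 | E1 | E2 | E3 | F1 | F2 | F3 | W2

definition G23_edges :: "(vertex \<times> vertex) list" where
  "G23_edges =
    [(W1,A1), (W1,A2), (W1,A3),
     (A1,A2), (A2,A3), (A1,B1), (A1,B2), (A1,B3), (A2,B2), (A2,B3), (A2,B4), (A3,B3), (A3,B4),
     (B1,B2), (B2,B3), (B3,B4), (B1,C1), (B1,C2), (B1,C3), (B2,C2), (B2,C3), (B2,C4),
       (B3,C3), (B3,C4), (B3,C5), (B4,C4), (B4,C5),
     (C1,C2), (C2,C3), (C3,C4), (C4,C5), (C1,D1), (C1,D2), (C1,D3), (C2,D2), (C2,D3), (C3,D3),
     (D1,D2), (D2,D3), (D1,E1), (D1,E2), (D2,E1), (D2,E2), (D2,E3), (D3,E2), (D3,E3), (D1,W2),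
     (E1,E2), (E2,E3), (E1,F1), (E1,F2), (E2,F1), (E2,F2), (E2,F3), (E3,F2), (E3,F3), (E1,W2),
     (F1,F2), (F2,F3), (F1,W2)]"

definition G23 :: "vertex pair_pre_digraph" where
  "G23 = \<lparr> pverts = UNIV, parcs = set G23_edges \<union> (set G23_edges)\<inverse> \<rparr>"

lemma UNIV_vertex:
  "UNIV = {W1, A1, A2, A3, B1, B2, B3, B4, C1, C2, C3, C4, C5, D1, D2, D3, E1, E2, E3, F1, F2, F3, W2}"
proof -
  have "v \<in> {W1, A1, A2, A3, B1, B2, B3, B4, C1, C2, C3, C4, C5, D1, D2, D3, E1, E2, E3, F1, F2, F3, W2}"
    for v by (cases v) simp_all
  then show ?thesis by blast
qed

lemma card_UNIV_vertex: "card (UNIV :: vertex set) = 23"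
  by (simp add: UNIV_vertex)

lemma length_G23_edges: "length G23_edges = 60"
  by (simp add: G23_edges_def)

lemma card_parcs_G23: "card (parcs G23) = 120"
  by (simp add: G23_def G23_edges_def)

lemma pair_graph_G23: "pair_graph G23"
proof
  show "finite (pverts G23)"
    by (simp add: G23_def UNIV_vertex)
  show "symmetric G23"
    by (auto simp: symmetric_def G23_def arcs_ends_def arc_to_ends_def with_proj_def intro!: symI)
  show "fst e \<noteq> snd e" if "e \<in> parcs G23" for e
    using that by (auto simp: G23_def G23_edges_def)
qed (simp_all add: G23_def)

lemma connected_G23: "connected (with_proj G23)"
proof -
  interpret pair_graph G23 by (rule pair_graph_G23)
  let ?R = "(parcs G23)\<^sup>*"
  have "sym (parcs G23)"
    by (auto simp: G23_def intro!: symI)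
  then have sym: "(v, u) \<in> ?R" if "(u, v) \<in> ?R" for u v
    using that by (metis sym_rtrancl symD)
  have step: "(W1, v) \<in> ?R" if "(W1, u) \<in> ?R" "(u, v) \<in> parcs G23" for u v
    using that by (rule rtrancl_into_rtrancl)
  have e: "(u, v) \<in> parcs G23" if "(u, v) \<in> set G23_edges" for u v
    using that by (simp add: G23_def)
  have a: "(W1, W1) \<in> ?R" "(W1, A1) \<in> ?R" "(W1, A2) \<in> ?R" "(W1, A3) \<in> ?R"
    by (auto intro!: e r_into_rtrancl simp: G23_edges_def)
  have b: "(W1, B1) \<in> ?R" "(W1, B2) \<in> ?R" "(W1, B3) \<in> ?R" "(W1, B4) \<in> ?R"
    by (rule step[OF a(2) e] step[OF a(3) e], simp add: G23_edges_def)+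
  have c: "(W1, C1) \<in> ?R" "(W1, C2) \<in> ?R" "(W1, C3) \<in> ?R" "(W1, C4) \<in> ?R" "(W1, C5) \<in> ?R"
    by (rule step[OF b(1) e] step[OF b(4) e], simp add: G23_edges_def)+
  have d: "(W1, D1) \<in> ?R" "(W1, D2) \<in> ?R" "(W1, D3) \<in> ?R"
    by (rule step[OF c(1) e], simp add: G23_edges_def)+
  have e': "(W1, E1) \<in> ?R" "(W1, E2) \<in> ?R" "(W1, E3) \<in> ?R" "(W1, W2) \<in> ?R"
    by (rule step[OF d(1) e] step[OF d(2) e], simp add: G23_edges_def)+
  have f: "(W1, F1) \<in> ?R" "(W1, F2) \<in> ?R" "(W1, F3) \<in> ?R"
    by (rule step[OF e'(2) e], simp add: G23_edges_def)+
  have from_W1: "(W1, v) \<in> ?R" for v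
    by (cases v) (use a b c d e' f in simp_all)
  have "(u, v) \<in> ?R" for u v
    using sym[OF from_W1] from_W1 by (rule rtrancl_trans)
  then have "(u, v) \<in> rtrancl_on UNIV (parcs G23)" for u v
    by (rule rtrancl_consistent_rtrancl_on) simp_all
  moreover have "pverts G23 = UNIV"
    by (simp add: G23_def)
  ultimately have "strongly_connected (with_proj G23)"
    by (simp add: strongly_connected_def reachable_def)
  moreover have "mk_symmetric (with_proj G23) = G23"
    by (auto simp: mk_symmetric_def G23_def with_proj_def)
  ultimately show ?thesis
    by (simp add: connected_def)
qed

end

theory Submission
  imports Defs
begin

text \<open>
  If \<open>{x, y}\<close> strongly resolves a supergraph \<open>H\<close> of \<open>G\<close>, then \<open>u \<mapsto> (d(u, x), d(u, y))\<close> embeds \<open>H\<close>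
  isometrically into the grid \<open>\<int>\<^sup>2\<close> with the maximum metric. Already as an injective map that sends
  edges of \<open>G\<close> to pairs at distance 1, this embedding is unique up to the symmetries of the grid:
  \<open>b\<^sub>3\<close> has eight neighbours, which fill the cells around it, and every other vertex is then forced
  by its neighbours. In this drawing \<open>c\<^sub>5\<close> and \<open>f\<^sub>3\<close> lie at distance 3 on a diagonal whose inner
  cells are empty, so no path of length 3 joins them in \<open>H\<close>.
\<close>

section \<open>Distances and shortest paths\<close>

definition gdist :: "'a rel \<Rightarrow> 'a \<Rightarrow> 'a \<Rightarrow> nat" where
  "gdist E u v = (LEAST n. (u, v) \<in> E ^^ n)"

lemma gdist_le: "(u, v) \<in> E ^^ n \<Longrightarrow> gdist E u v \<le> n"
  unfolding gdist_def by (rule Least_le)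

lemma relpow_gdist: "(u, v) \<in> E\<^sup>* \<Longrightarrow> (u, v) \<in> E ^^ gdist E u v"
  unfolding gdist_def by (metis LeastI rtrancl_imp_relpow)

lemma gdist_relpow_triangle:
  assumes "(u, v) \<in> E ^^ n" and "(v, w) \<in> E\<^sup>*"
  shows "gdist E u w \<le> n + gdist E v w"
proof -
  have "(u, w) \<in> E ^^ (n + gdist E v w)"
    using assms(1) relpow_gdist[OF assms(2)] by (auto simp: relpow_add)
  then show ?thesis by (rule gdist_le)
qed

lemma sym_relpow:
  assumes "sym E" and "(u, v) \<in> E ^^ n"
  shows "(v, u) \<in> E ^^ n"
  using assms(2)
proof (induction n arbitrary: v)
  case (Suc n)
  then show ?case by (metis assms(1) relpow_Suc_E relpow_Suc_I2 symD)
qed simp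

lemma vwalk_imp_relpow:
  assumes "vwalk p (with_proj H)"
  shows "(hd p, last p) \<in> parcs H ^^ (length p - 1)"
  using assms
proof (induction p rule: vwalk_induct)
  case (Cons u v es)
  then show ?case by (auto intro: relpow_Suc_I2 simp del: relpow.simps)
qed simp

lemma (in pair_wf_digraph) relpow_imp_vwalk:
  assumes "(u, v) \<in> parcs G ^^ n" and "u \<in> pverts G"
  shows "\<exists>p. vwalk p (with_proj G) \<and> hd p = u \<and> last p = v \<and> length p = Suc n"
  using assms
proof (induction n arbitrary: u)
  case 0
  then show ?case by (intro exI[of _ "[u]"]) auto
next
  case (Suc n)
  then obtain u' where u': "(u, u') \<in> parcs G" "(u', v) \<in> parcs G ^^ n"
    by (meson relpow_Suc_D2)
  with Suc.IH obtain p where p: "vwalk p (with_proj G)" "hd p = u'" "last p = v" "length p = Suc n"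
    using in_arcsD2 by blast
  then have "vwalk (u # p) (with_proj G)"
    using u' Suc.prems by (auto intro: vwalk_consI)
  with p show ?case by (intro exI[of _ "u # p"]) auto
qed

lemma length_vwalk_to_vpath_le: "length (vwalk_to_vpath p) \<le> length p"
proof (induction p rule: vwalk_to_vpath_induct3)
  case (in_set x xs)
  then show ?case by (simp add: le_SucI le_trans[OF _ length_dropWhile_le])
qed simp_all

text \<open>\<open>shortest_path\<close> minimises over paths, \<open>gdist\<close> over all walks;
  shortcutting a walk to a path never lengthens it. The \<open>- 1\<close> turns a number of
  vertices into a number of arcs.\<close>

lemma (in pair_wf_digraph) length_shortest_path_le:
  assumes "shortest_path G u p w"
  shows "length p - 1 \<le> gdist (parcs G) u w"
proof -
  have p: "vwalk p (with_proj G)" "hd p = u" "last p = w"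
    using assms by (auto simp: shortest_path_def vpath_def)
  then have "(u, w) \<in> (parcs G)\<^sup>*"
    using vwalk_imp_relpow[OF p(1)] by (auto dest: relpow_imp_rtrancl)
  moreover have "u \<in> pverts G"
    using p by (auto simp: vwalk_def)
  ultimately obtain q where q: "vwalk q (with_proj G)" "hd q = u" "last q = w"
      "length q = Suc (gdist (parcs G) u w)"
    using relpow_imp_vwalk relpow_gdist by metis
  have "vpath (vwalk_to_vpath q) (with_proj G)"
    by (rule vwalk_to_vpath_vpath) fact
  then have "length p - 1 \<le> length (vwalk_to_vpath q) - 1"
    using assms q by (auto simp: shortest_path_def vwalk_to_vpath_hd vwalk_to_vpath_last)
  then show ?thesis using length_vwalk_to_vpath_le[of q] q(4) by simp
qed

text \<open>Cutting \<open>p\<close> at \<open>v\<close> gives a walk of \<open>k\<close> arcs up to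
  \<open>v\<close> and a tail that bounds the distance from \<open>v\<close> to
  \<open>w\<close>.\<close>

lemma (in pair_wf_digraph) shortest_path_via:
  assumes "shortest_path G u p w" and "v \<in> set p"
  shows "\<exists>k. (u, v) \<in> parcs G ^^ k \<and> k + gdist (parcs G) v w \<le> gdist (parcs G) u w"
proof -
  have p: "vwalk p (with_proj G)" "hd p = u" "last p = w"
    using assms by (auto simp: shortest_path_def vpath_def)
  obtain xs ys where xs: "p = xs @ v # ys" using assms(2) by (meson split_list)
  have "vwalk (xs @ [v]) (with_proj G)"
    by (rule vwalkI_append_l[where q = ys]) (use p xs in auto)
  from vwalk_imp_relpow[OF this] have 1: "(u, v) \<in> parcs G ^^ length xs"
    using p xs by (cases xs) auto
  have "vwalk (v # ys) (with_proj G)"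
    by (rule vwalkI_append_r[where p = xs]) (use p xs in auto)
  from vwalk_imp_relpow[OF this] have "gdist (parcs G) v w \<le> length ys"
    using p xs by (auto intro: gdist_le)
  with 1 length_shortest_path_le[OF assms(1)] show ?thesis using xs by auto
qed

lemma (in pair_wf_digraph) ex_shortest_path:
  assumes "(u, w) \<in> (parcs G)\<^sup>*" and "u \<in> pverts G"
  shows "\<exists>p. shortest_path G u p w"
proof -
  obtain p where "vpath p (with_proj G) \<and> hd p = u \<and> last p = w"
    using relpow_imp_vwalk assms rtrancl_imp_relpow vwalk_imp_ex_vpath by metis
  from ex_has_least_nat[of "\<lambda>p. vpath p (with_proj G) \<and> hd p = u \<and> last p = w", OF this, of vwalk_length]
  show ?thesis by (auto simp: shortest_path_def)
qed

text \<open>A vertex resolves every pair containing it. This makes the \<open>LEAST\<close> in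
  \<open>strong_dim\<close> a minimum over a nonempty set.\<close>

lemma (in pair_wf_digraph) strong_resolving_set_pverts:
  assumes "\<And>u v. u \<in> pverts G \<Longrightarrow> v \<in> pverts G \<Longrightarrow> (u, v) \<in> (parcs G)\<^sup>*"
  shows "strong_resolving_set G (pverts G)"
proof -
  have "strongly_resolves G v u v" if uv: "u \<in> pverts G" "v \<in> pverts G" for u v
  proof -
    obtain p where p: "shortest_path G u p v"
      using ex_shortest_path assms uv by blast
    then have "v \<in> set p" by (auto simp: shortest_path_def vpath_def vwalk_def)
    with p show ?thesis by (auto simp: strongly_resolves_def)
  qed
  then show ?thesis by (auto simp: strong_resolving_set_def)
qed

section \<open>Drawings of the graph in the grid\<close>

locale grid_drawing =
  fixes X Y :: "vertex \<Rightarrow> int"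
  assumes near_edge: "(u, v) \<in> set G23_edges \<Longrightarrow> \<bar>X u - X v\<bar> \<le> 1 \<and> \<bar>Y u - Y v\<bar> \<le> 1"
    and inj: "u \<noteq> v \<Longrightarrow> X u \<noteq> X v \<or> Y u \<noteq> Y v"
begin

lemma near:
  "(u, v) \<in> set G23_edges \<or> (v, u) \<in> set G23_edges \<Longrightarrow>
    X u \<le> X v + 1 \<and> X v \<le> X u + 1 \<and> Y u \<le> Y v + 1 \<and> Y v \<le> Y u + 1 \<and> (X u \<noteq> X v \<or> Y u \<noteq> Y v)"
proof -
  assume e: "(u, v) \<in> set G23_edges \<or> (v, u) \<in> set G23_edges"
  have "\<forall>(u, v) \<in> set G23_edges. u \<noteq> v"
    by (simp add: G23_edges_def)
  then have "u \<noteq> v" using e by blast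
  moreover have "\<bar>X u - X v\<bar> \<le> 1 \<and> \<bar>Y u - Y v\<bar> \<le> 1"
    using e near_edge[of u v] near_edge[of v u] by (auto simp: abs_minus_commute)
  ultimately show ?thesis using inj[of u v] by linarith
qed

text \<open>Diagonally adjacent cells have only two common neighbours.\<close>
lemma three_common_neighbours:
  assumes "distinct [p, q, r]"
    and "\<forall>(s, t) \<in> {(u, v), (u, p), (u, q), (u, r), (v, p), (v, q), (v, r)}.
      (s, t) \<in> set G23_edges \<or> (t, s) \<in> set G23_edges"
  shows "X u = X v \<or> Y u = Y v"
proof (rule ccontr)
  assume diag: "\<not> ?thesis"
  have "X z = X u \<and> Y z = Y v \<or> X z = X v \<and> Y z = Y u" if "z \<in> {p, q, r}" for z
  proof -
    have "(u, z) \<in> set G23_edges \<or> (z, u) \<in> set G23_edges"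
      "(v, z) \<in> set G23_edges \<or> (z, v) \<in> set G23_edges"
      "(u, v) \<in> set G23_edges \<or> (v, u) \<in> set G23_edges"
      using that assms(2) by auto
    from this[THEN near] diag show ?thesis by smt
  qed
  \<comment> \<open>Two cells cannot hold three distinct vertices.\<close>
  from this[of p] this[of q] this[of r] inj[of p q] inj[of p r] inj[of q r] assms(1)
  show False by auto
qed

end

section \<open>Symmetries of the grid and the normal form\<close>

lemma grid_drawing_swap: "grid_drawing X Y \<Longrightarrow> grid_drawing Y X"
  by (auto simp: grid_drawing_def)

lemma grid_drawing_affine:
  assumes "grid_drawing X Y" and s: "s \<in> {-1, 1}" and t: "t \<in> {-1, 1}"
  shows "grid_drawing (\<lambda>u. s * X u + a) (\<lambda>u. t * Y u + b)"
proof -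
  interpret grid_drawing X Y by fact
  show ?thesis
  proof
    show "\<bar>s * X u + a - (s * X v + a)\<bar> \<le> 1 \<and> \<bar>t * Y u + b - (t * Y v + b)\<bar> \<le> 1"
      if "(u, v) \<in> set G23_edges" for u v
      using near_edge[OF that] s t by auto
    show "s * X u + a \<noteq> s * X v + a \<or> t * Y u + b \<noteq> t * Y v + b" if "u \<noteq> v" for u v
      using inj[OF that] s t by auto
  qed
qed

text \<open>The coordinates of the normal form are the distances to \<^term>\<open>W1\<close> and \<^term>\<open>W2\<close> in \<^term>\<open>G23\<close>.\<close>
locale normal_drawing = grid_drawing +
  assumes B3: "X B3 = 2 \<and> Y B3 = 5" and A2: "X A2 = 1 \<and> Y A2 = 5" and B2: "X B2 = 2 \<and> Y B2 = 4"
begin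

text \<open>\<open>B4\<close> shares a row or column with \<open>B3\<close>; adjacency to
  \<open>A2\<close> and the occupied cell of \<open>B2\<close> leave one place. \<open>E2\<close> is
  placed beside \<open>D2\<close> likewise.\<close>

lemma B4: "X B4 = 2 \<and> Y B4 = 6"
  using three_common_neighbours[of A2 A3 C4 B3 B4]
    near[of B4 B3] near[of B4 A2] inj[of B4 B2] B3 A2 B2
  by (simp add: G23_edges_def) smt

lemma C4: "X C4 = 3 \<and> Y C4 = 5"
  using three_common_neighbours[of B2 B4 C3 B3 C4]
    near[of C4 B3] near[of C4 B4] near[of C4 B2] inj[of C4 A2] B3 A2 B2 B4
  by (simp add: G23_edges_def)

text \<open>Three cells of a 2 by 2 square have only the fourth as common neighbour. This also
  places \<open>A3\<close>, \<open>C3\<close>, \<open>C5\<close>, \<open>C2\<close>,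
  \<open>D2\<close>, \<open>E1\<close>, \<open>E3\<close>, \<open>F1\<close> and
  \<open>F3\<close>.\<close>

lemma A1: "X A1 = 1 \<and> Y A1 = 4"
  using near[of A1 A2] near[of A1 B2] near[of A1 B3] A2 B2 B3 by (simp add: G23_edges_def) smt

lemma A3: "X A3 = 1 \<and> Y A3 = 6"
  using near[of A3 A2] near[of A3 B4] near[of A3 B3] A2 B4 B3 by (simp add: G23_edges_def) smt

lemma C3: "X C3 = 3 \<and> Y C3 = 4"
  using near[of C3 B2] near[of C3 B3] near[of C3 C4] B2 B3 C4 by (simp add: G23_edges_def) smt

lemma C5: "X C5 = 3 \<and> Y C5 = 6"
  using near[of C5 B3] near[of C5 B4] near[of C5 C4] B3 B4 C4 by (simp add: G23_edges_def) smt

text \<open>Three consecutive cells of a row or column have two common neighbours, on either side of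
  the middle cell, and one is taken. This also places \<open>D1\<close>, \<open>F2\<close>,
  \<open>W1\<close> and \<open>W2\<close>.\<close>

lemma B1: "X B1 = 2 \<and> Y B1 = 3"
  using near[of B1 A1] near[of B1 B2] near[of B1 C3] inj[of B1 B3] A1 B2 B3 C3
  by (simp add: G23_edges_def)

lemma C2: "X C2 = 3 \<and> Y C2 = 3"
  using near[of C2 B1] near[of C2 B2] near[of C2 C3] B1 B2 C3 by (simp add: G23_edges_def) smt

text \<open>\<open>C2\<close> and \<open>C3\<close> leave two free cells for \<open>D3\<close>.
  Either choice forces the same cell for \<open>C1\<close>, which then decides
  \<open>D3\<close>.\<close>

lemma C1_D3: "(X C1 = 3 \<and> Y C1 = 2) \<and> X D3 = 4 \<and> Y D3 = 3"
proof -
  have D3: "X D3 = 4 \<and> 3 \<le> Y D3"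
    using near[of D3 C2] near[of D3 C3] inj[of D3 B1] inj[of D3 B2] B1 B2 C2 C3
    by (simp add: G23_edges_def) smt
  then have "X C1 = 3 \<and> Y C1 = 2"
    using near[of C1 B1] near[of C1 C2] near[of C1 D3] inj[of C1 C3] B1 C2 C3
    by (simp add: G23_edges_def)
  with D3 show ?thesis using near[of D3 C1] by (simp add: G23_edges_def)
qed

lemmas C1 = C1_D3[THEN conjunct1] and D3 = C1_D3[THEN conjunct2]

lemma D2: "X D2 = 4 \<and> Y D2 = 2"
  using near[of D2 C1] near[of D2 C2] near[of D2 D3] C1 C2 D3 by (simp add: G23_edges_def) smt

lemma E2: "X E2 = 5 \<and> Y E2 = 2"
  using three_common_neighbours[of D1 D3 E1 D2 E2]
    near[of E2 D2] near[of E2 D3] inj[of E2 C1] C1 D2 D3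
  by (simp add: G23_edges_def) smt

lemma D1: "X D1 = 4 \<and> Y D1 = 1"
  using near[of D1 C1] near[of D1 D2] near[of D1 E2] inj[of D1 D3] C1 D2 D3 E2
  by (simp add: G23_edges_def)

lemma E1: "X E1 = 5 \<and> Y E1 = 1"
  using near[of E1 D1] near[of E1 D2] near[of E1 E2] D1 D2 E2 by (simp add: G23_edges_def) smt

lemma E3: "X E3 = 5 \<and> Y E3 = 3"
  using near[of E3 D2] near[of E3 D3] near[of E3 E2] D2 D3 E2 by (simp add: G23_edges_def) smt

lemma F2: "X F2 = 6 \<and> Y F2 = 2"
  using near[of F2 E1] near[of F2 E2] near[of F2 E3] inj[of F2 D2] D2 E1 E2 E3
  by (simp add: G23_edges_def)

lemma F1: "X F1 = 6 \<and> Y F1 = 1"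
  using near[of F1 E1] near[of F1 E2] near[of F1 F2] E1 E2 F2 by (simp add: G23_edges_def) smt

lemma F3: "X F3 = 6 \<and> Y F3 = 3"
  using near[of F3 E2] near[of F3 E3] near[of F3 F2] E2 E3 F2 by (simp add: G23_edges_def) smt

lemma W1: "X W1 = 0 \<and> Y W1 = 5"
  using near[of W1 A1] near[of W1 A2] near[of W1 A3] inj[of W1 B3] A1 A2 A3 B3
  by (simp add: G23_edges_def)

lemma W2: "X W2 = 5 \<and> Y W2 = 0"
  using near[of W2 D1] near[of W2 E1] near[of W2 F1] inj[of W2 E2] D1 E1 E2 F1
  by (simp add: G23_edges_def)

lemma no_vertex_at_4_5: "\<not> (X p = 4 \<and> Y p = 5)"
  using W1 A1 A2 A3 B1 B2 B3 B4 C1 C2 C3 C4 C5 D1 D2 D3 E1 E2 E3 F1 F2 F3 W2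
  by (cases p) simp_all

text \<open>The cells of \<^term>\<open>C5\<close> and \<^term>\<open>F3\<close> are the ends of a diagonal of length 3, so the only
  candidate for \<open>p\<close> is the next cell of that diagonal.\<close>
lemma C5_F3_gap:
  "\<bar>X C5 - X F3\<bar> = 3 \<and> \<bar>Y C5 - Y F3\<bar> = 3 \<and>
    \<not> (\<exists>p. \<bar>X C5 - X p\<bar> \<le> 1 \<and> \<bar>Y C5 - Y p\<bar> \<le> 1 \<and> \<bar>X p - X F3\<bar> \<le> 2 \<and> \<bar>Y p - Y F3\<bar> \<le> 2)"
proof -
  have "X p = 4 \<and> Y p = 5"
    if "\<bar>X C5 - X p\<bar> \<le> 1" "\<bar>Y C5 - Y p\<bar> \<le> 1" "\<bar>X p - X F3\<bar> \<le> 2" "\<bar>Y p - Y F3\<bar> \<le> 2" for p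
    using that C5 F3 by auto
  with no_vertex_at_4_5 C5 F3 show ?thesis by auto
qed

end

text \<open>\<open>A2\<close> and \<open>B2\<close> are adjacent and each lies beside
  \<open>B3\<close>, so they lie on perpendicular sides of it. A symmetry of the grid, which
  preserves the claim, brings them into normal form.\<close>

lemma (in grid_drawing) C5_F3_gap:
  "\<bar>X C5 - X F3\<bar> = 3 \<and> \<bar>Y C5 - Y F3\<bar> = 3 \<and>
    \<not> (\<exists>p. \<bar>X C5 - X p\<bar> \<le> 1 \<and> \<bar>Y C5 - Y p\<bar> \<le> 1 \<and> \<bar>X p - X F3\<bar> \<le> 2 \<and> \<bar>Y p - Y F3\<bar> \<le> 2)"
proof -
  \<comment> \<open>Stated for fresh \<open>X\<close> and \<open>Y\<close>, to be applied to the
    swapped drawing too.\<close>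
  have horizontal: "\<bar>X C5 - X F3\<bar> = 3 \<and> \<bar>Y C5 - Y F3\<bar> = 3 \<and>
    \<not> (\<exists>p. \<bar>X C5 - X p\<bar> \<le> 1 \<and> \<bar>Y C5 - Y p\<bar> \<le> 1 \<and> \<bar>X p - X F3\<bar> \<le> 2 \<and> \<bar>Y p - Y F3\<bar> \<le> 2)"
    if "grid_drawing X Y" and A2: "Y A2 = Y B3" and B2: "X B2 = X B3" for X Y
  proof -
    interpret D: grid_drawing X Y by fact
    define s t where "s = X B3 - X A2" and "t = Y B3 - Y B2"
    have st: "s \<in> {-1, 1}" "t \<in> {-1, 1}"
      using D.near[of A2 B3] D.near[of B2 B3] A2 B2
      by (auto simp: G23_edges_def s_def t_def)
    have X_A2: "X A2 = X B3 - s" and Y_B2: "Y B2 = Y B3 - t"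
      by (simp_all add: s_def t_def)
    \<comment> \<open>The signs reflect \<open>A2\<close> and \<open>B2\<close> to the sides of
      smaller coordinates; the translation moves \<open>B3\<close> to (2, 5).\<close>
    let ?X = "\<lambda>u. s * X u + (2 - s * X B3)" and ?Y = "\<lambda>u. t * Y u + (5 - t * Y B3)"
    interpret N: grid_drawing ?X ?Y
      by (rule grid_drawing_affine) (use that st in auto)
    interpret N: normal_drawing ?X ?Y
      by unfold_locales (use st in \<open>auto simp: A2 B2 X_A2 Y_B2\<close>)
    show ?thesis
      using N.C5_F3_gap st by (auto simp: abs_minus_commute)
  qed
  have "X A2 = X B3 \<or> Y A2 = Y B3"
    by (rule three_common_neighbours[of A1 A3 B2]) (simp_all add: G23_edges_def)
  moreover have "X B2 = X B3 \<or> Y B2 = Y B3"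
    by (rule three_common_neighbours[of A1 A2 C3]) (simp_all add: G23_edges_def)
  moreover have "X A2 = X B3 \<and> X B2 = X B3 \<longrightarrow> False" "Y A2 = Y B3 \<and> Y B2 = Y B3 \<longrightarrow> False"
    using near[of A2 B3] near[of B2 B3] near[of A2 B2] by (simp add: G23_edges_def, smt)+
  ultimately consider "Y A2 = Y B3" "X B2 = X B3" | "X A2 = X B3" "Y B2 = Y B3"
    by blast
  then show ?thesis
  proof cases
    case 1
    then show ?thesis using horizontal grid_drawing_axioms by blast
  next
    case 2
    then show ?thesis using horizontal[OF grid_drawing_swap] grid_drawing_axioms by blast
  qed
qed

section \<open>Resolving sets of supergraphs\<close>

lemma reachable_G23: "(u, v) \<in> (parcs G23)\<^sup>*"
proof -
  have "mk_symmetric (with_proj G23) = G23"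
    by (auto simp: mk_symmetric_def G23_def with_proj_def)
  then have "(u, v) \<in> rtrancl_on (pverts G23) (parcs G23)"
    using connected_G23 by (auto simp: connected_def strongly_connected_def reachable_def G23_def)
  then show ?thesis by (rule rtrancl_on_rtranclI)
qed

lemma strong_resolving_set_card_gt_2:
  assumes H: "pair_graph H" "spanning (with_proj G23) (with_proj H)"
    and W: "strong_resolving_set H W"
  shows "card W > 2"
proof (rule ccontr)
  assume "\<not> card W > 2"
  interpret pair_graph H by fact
  let ?E = "parcs H"
  have sub: "parcs G23 \<subseteq> ?E" and verts: "pverts H = UNIV"
    using H(2) by (auto simp: spanning_def subgraph_def G23_def)
  have reach: "(u, v) \<in> ?E\<^sup>*" for u v
    using rtrancl_mono[OF sub] reachable_G23 by blast
  have sym: "sym ?E"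
    using pair_sym_arcs by (simp add: symmetric_def)
  have "finite W"
    using W pair_finite_verts by (auto simp: strong_resolving_set_def intro: finite_subset)
  \<comment> \<open>\<open>x\<close> and \<open>y\<close> may coincide or lie outside
    \<open>W\<close>, so smaller sets are covered as well.\<close>
  then obtain x y where xy: "W \<subseteq> {x, y}"
  proof -
    consider "card W = 0" | "card W = 1" | "card W = 2"
      using \<open>\<not> card W > 2\<close> by linarith
    then show ?thesis
      by cases (use that \<open>finite W\<close> in \<open>auto simp: card_1_singleton_iff card_2_iff\<close>)
  qed
  \<comment> \<open>This bound yields both injectivity, where it forces \<open>k = 0\<close>, and a
    short walk from \<open>C5\<close> to \<open>F3\<close>.\<close>
  have resolve: "\<exists>k. (u, v) \<in> ?E ^^ k \<and> (\<exists>w \<in> {x, y}.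
      int k \<le> \<bar>int (gdist ?E u w) - int (gdist ?E v w)\<bar>)" if "u \<noteq> v" for u v
  proof -
    have "\<exists>w \<in> W. strongly_resolves H w u v"
      using W verts that by (simp add: strong_resolving_set_def)
    then obtain w where w: "w \<in> {x, y}" "strongly_resolves H w u v"
      using xy by blast
    then consider k where "(u, v) \<in> ?E ^^ k" "k + gdist ?E v w \<le> gdist ?E u w"
      | k where "(v, u) \<in> ?E ^^ k" "k + gdist ?E u w \<le> gdist ?E v w"
      unfolding strongly_resolves_def using shortest_path_via by metis
    then show ?thesis
    proof cases
      case (1 k)
      with w show ?thesis by (intro exI[of _ k] conjI bexI[of _ w]) auto
    next
      case (2 k)
      with w show ?thesis
        by (intro exI[of _ k] conjI bexI[of _ w]) (auto intro: sym_relpow[OF sym])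
    qed
  qed
  have lipschitz: "\<bar>int (gdist ?E u w) - int (gdist ?E v w)\<bar> \<le> int n" if "(u, v) \<in> ?E ^^ n" for u v w n
    using gdist_relpow_triangle[OF that reach, of w]
      gdist_relpow_triangle[OF sym_relpow[OF sym that] reach, of w] by linarith
  define X Y where "X u = int (gdist ?E u x)" and "Y u = int (gdist ?E u y)" for u
  interpret grid_drawing X Y
  proof
    show "\<bar>X u - X v\<bar> \<le> 1 \<and> \<bar>Y u - Y v\<bar> \<le> 1" if "(u, v) \<in> set G23_edges" for u v
    proof -
      have "(u, v) \<in> ?E ^^ 1" using that sub by (auto simp: G23_def)
      from lipschitz[OF this] show ?thesis by (simp add: X_def Y_def)
    qed
    show "X u \<noteq> X v \<or> Y u \<noteq> Y v" if "u \<noteq> v" for u v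
    proof (rule ccontr)
      assume "\<not> ?thesis"
      with resolve[OF that] have "(u, v) \<in> ?E ^^ 0" by (auto simp: X_def Y_def)
      with that show False by simp
    qed
  qed
  \<comment> \<open>Both coordinates differ by 3, so either resolving vertex gives a walk of at most
    3 arcs; its second vertex \<open>p\<close> would fill the gap.\<close>
  obtain k where k: "(C5, F3) \<in> ?E ^^ k" "k \<le> 3"
    using resolve[of C5 F3] C5_F3_gap by (fastforce simp: X_def Y_def)
  then obtain m where m: "k = Suc m" by (cases k) auto
  then obtain p where p: "(C5, p) \<in> ?E ^^ 1" "(p, F3) \<in> ?E ^^ m"
    using k by (metis relpow_1 relpow_Suc_D2)
  have "\<bar>X C5 - X p\<bar> \<le> 1 \<and> \<bar>Y C5 - Y p\<bar> \<le> 1 \<and> \<bar>X p - X F3\<bar> \<le> 2 \<and> \<bar>Y p - Y F3\<bar> \<le> 2"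
    using lipschitz[OF p(1), of x] lipschitz[OF p(1), of y]
      lipschitz[OF p(2), of x] lipschitz[OF p(2), of y] k m by (auto simp: X_def Y_def)
  with C5_F3_gap show False by blast
qed

text \<open>Since some resolving set exists, \<open>strong_dim H\<close> is the size of one.\<close>

lemma strong_dim_gt_2:
  assumes H: "pair_graph H" "spanning (with_proj G23) (with_proj H)"
  shows "strong_dim H > 2"
proof -
  interpret pair_graph H by fact
  have "parcs G23 \<subseteq> parcs H"
    using H(2) by (auto simp: spanning_def subgraph_def G23_def)
  then have "strong_resolving_set H (pverts H)"
    by (intro strong_resolving_set_pverts) (use rtrancl_mono reachable_G23 in blast)
  then have "\<exists>k W. strong_resolving_set H W \<and> card W = k" by blast
  from LeastI_ex[OF this] obtain W where "strong_resolving_set H W" "card W = strong_dim H"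
    unfolding strong_dim_def by blast
  then show ?thesis using strong_resolving_set_card_gt_2[OF H] by metis
qed

theorem theorem3p7:
  shows "threshold_strong_dim G23 > 2 \<and>
    \<not> (\<exists>H. pair_graph H \<and> spanning (with_proj G23) (with_proj H) \<and> strong_dim H = 2)"
proof -
  \<comment> \<open>\<open>G23\<close> is its own supergraph, so the outer \<open>LEAST\<close> is
    attained too.\<close>
  have "spanning (with_proj G23) (with_proj G23)"
    using pair_graph_G23
    by (auto simp: spanning_def subgraph_def compatible_def wf_digraph_wp_iff pair_graph_def
        pair_digraph_def pair_fin_digraph_def)
  then have "\<exists>k H. pair_graph H \<and> spanning (with_proj G23) (with_proj H) \<and> strong_dim H = k"
    using pair_graph_G23 by blast
  from LeastI_ex[OF this] obtain H where "pair_graph H"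
    "spanning (with_proj G23) (with_proj H)" "strong_dim H = threshold_strong_dim G23"
    unfolding threshold_strong_dim_def by blast
  then have "threshold_strong_dim G23 > 2" using strong_dim_gt_2 by metis
  then show ?thesis using strong_dim_gt_2 less_irrefl by metis
qed

end
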